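(* Let $w$ be a double occurrence word over the alphabet $\Sigma=\{1,2,\dots,n\}$ with $|w|=2n$. Then the following are equivalent: (1) for every proper non-empty subset $\sigma\subset\Sigma$, at least one word in $w\setminus\sigma$ has odd length; (2) $w=w_{TC_n}$ up to renaming of the letters.
   Context: A double occurrence word is a non-empty word in which each letter of the alphabet occurs exactly twice or not at all. For a word $w$ and a non-empty set of letters $\sigma$, $w\setminus\sigma$ denotes the sequence of non-empty subwords obtained from $w$ by deleting all occurrences of letters of $\sigma$ (i.e. the maximal contiguous blocks of $w$ containing no letter of $\sigma$). The tangled cord word is $w_{TC_n}=1\,2\,1\,3\,2\,4\,3\dots n\,(n-1)\,n$ (e.g. $w_{TC_1}=11$, $w_{TC_2}=1212$, $w_{TC_3}=121323$, $w_{TC_4}=12132434$). *)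

theory Defs
  imports Main
begin

definition double_occurrence_word :: "'a list \<Rightarrow> bool" where
  "double_occurrence_word w \<longleftrightarrow> w \<noteq> [] \<and> (\<forall>a. count_list w a = 0 \<or> count_list w a = 2)"

fun split_at_letters :: "'a set \<Rightarrow> 'a list \<Rightarrow> 'a list list" where
  "split_at_letters \<sigma> [] = [[]]"
| "split_at_letters \<sigma> (x # xs) =
    (if x \<in> \<sigma> then [] # split_at_letters \<sigma> xs
     else (x # hd (split_at_letters \<sigma> xs)) # tl (split_at_letters \<sigma> xs))"

definition delete_letters :: "'a list \<Rightarrow> 'a set \<Rightarrow> 'a list list" where
  "delete_letters w \<sigma> = filter (\<lambda>u. u \<noteq> []) (split_at_letters \<sigma> w)"

(* The word 1 (2 1) (3 2) ... (n (n-1)) n; only meaningful for n >= 1. *)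
definition tangled_cord_word :: "nat \<Rightarrow> nat list" where
  "tangled_cord_word n = 1 # concat (map (\<lambda>i. [Suc i, i]) [1..<n]) @ [n]"

definition equal_up_to_renaming :: "nat \<Rightarrow> nat list \<Rightarrow> nat list \<Rightarrow> bool" where
  "equal_up_to_renaming n v w \<longleftrightarrow> (\<exists>f. bij_betw f {1..n} {1..n} \<and> v = map f w)"

lemma "tangled_cord_word 1 = [1, 1]"
  by (simp add: tangled_cord_word_def)

lemma "tangled_cord_word 2 = [1, 2, 1, 2]"
  by (simp add: tangled_cord_word_def upt_rec)

lemma "tangled_cord_word 4 = [1, 2, 1, 3, 2, 4, 3, 4]"
  by (simp add: tangled_cord_word_def upt_rec)

lemma "delete_letters [1, 2, 1, 3, 2, 3] {1 :: nat} = [[2], [3, 2, 3]]"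
  by (simp add: delete_letters_def)

lemma "delete_letters [1, 2, 1, 3, 2, 3] {2 :: nat} = [[1], [1, 3], [3]]"
  by (simp add: delete_letters_def)

end

theory Submission
  imports Defs
begin

text \<open>
  All blocks of \<open>w \ \<sigma>\<close> are even iff the positions of the letters outside \<open>\<sigma>\<close> can be tiled by
  dominoes \<open>{p, p + 1}\<close>. Number the positions from \<open>0\<close> and let \<open>\<alpha>\<close> swap \<open>2i\<close> and \<open>2i + 1\<close>,
  \<open>\<beta>\<close> swap \<open>2i - 1\<close> and \<open>2i\<close> (cyclically), and \<open>\<tau>\<close> swap the two occurrences of each letter.
  A tiling is then a disjoint union of an \<open>\<alpha>\<close>-closed set \<open>A\<close> and a \<open>\<beta>\<close>-closed set \<open>B\<close> not
  containing \<open>0\<close>, with \<open>A \<union> B\<close> closed under \<open>\<tau>\<close>; condition (1) says that such a union, if non-empty,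
  is everything.

  Under this condition \<open>\<tau> 0 = 2\<close>. The walk \<open>y\<^sub>k = (\<beta>\<tau>)\<^sup>k 0\<close> must reach position \<open>1\<close>, at time \<open>k\<close> say.
  If \<open>k > 1\<close>, let the walk \<open>(\<alpha>\<tau>)\<^sup>r 1\<close> run until it first meets a letter visited by \<open>y\<close> before time \<open>k\<close>.
  Closing it up along a piece of \<open>y\<close> gives a tiling that either misses \<open>0\<close>, or whose \<open>\<beta>\<close>-part
  is also closed under \<open>\<alpha>\<close>; both are impossible.

  Hence \<open>w = a b a v\<close>, and \<open>w\<close> satisfies (1) iff \<open>b v\<close> does. The tangled cord words have the same
  recursive structure, so both directions follow by induction.
\<close>

section \<open>Words with even blocks\<close>

text \<open>A kept letter is consumed only together with a kept right neighbour, so the recursion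
  itself displays the domino tiling of the letters outside \<open>\<sigma>\<close>.\<close>

fun even_blocks :: "'a set \<Rightarrow> 'a list \<Rightarrow> bool" where
  "even_blocks \<sigma> [] \<longleftrightarrow> True"
| "even_blocks \<sigma> [x] \<longleftrightarrow> x \<in> \<sigma>"
| "even_blocks \<sigma> (x # y # ys) \<longleftrightarrow>
    (if x \<in> \<sigma> then even_blocks \<sigma> (y # ys) else y \<notin> \<sigma> \<and> even_blocks \<sigma> ys)"

lemma even_blocks_Cons_mem: "x \<in> \<sigma> \<Longrightarrow> even_blocks \<sigma> (x # xs) \<longleftrightarrow> even_blocks \<sigma> xs"
  by (cases xs) auto

lemma even_blocks_Cons_notmem:
  "x \<notin> \<sigma> \<Longrightarrow> even_blocks \<sigma> (x # xs) \<longleftrightarrow> (\<exists>y ys. xs = y # ys \<and> y \<notin> \<sigma> \<and> even_blocks \<sigma> ys)"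
  by (cases xs) auto

lemma even_blocks_cong:
  "(\<And>x. x \<in> set w \<Longrightarrow> x \<in> \<sigma> \<longleftrightarrow> x \<in> \<tau>) \<Longrightarrow> even_blocks \<sigma> w \<longleftrightarrow> even_blocks \<tau> w"
  by (induction \<sigma> w rule: even_blocks.induct) auto

lemma split_at_letters_nonempty: "split_at_letters \<sigma> w \<noteq> []"
  by (cases w) auto

lemma even_blocks_iff_split:
  "(\<forall>u \<in> set (split_at_letters \<sigma> w). even (length u)) \<longleftrightarrow> even_blocks \<sigma> w"
proof (induction \<sigma> w rule: even_blocks.induct)
  case (3 \<sigma> x y ys)
  obtain r rs where r: "split_at_letters \<sigma> ys = r # rs"
    using split_at_letters_nonempty[of \<sigma> ys] by (cases "split_at_letters \<sigma> ys") auto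
  show ?case
    using 3 r by auto
qed auto

text \<open>Empty blocks have even length, so filtering them out does not affect the
  condition.\<close>

lemma even_blocks_iff_delete:
  "(\<forall>u \<in> set (delete_letters w \<sigma>). even (length u)) \<longleftrightarrow> even_blocks \<sigma> w"
  unfolding even_blocks_iff_split[symmetric] delete_letters_def by auto

text \<open>Condition (1) relative to the letters of \<open>w\<close> itself, so that it passes to
  the shorter words of the induction, whose letters need not form an initial segment.\<close>

definition no_even_deletion :: "'a list \<Rightarrow> bool" where
  "no_even_deletion w \<longleftrightarrow> (\<forall>\<sigma>. \<sigma> \<subset> set w \<and> \<sigma> \<noteq> {} \<longrightarrow> \<not> even_blocks \<sigma> w)"

text \<open>If all blocks of \<open>a # b # a # v\<close> are even, \<open>a\<close> and
  \<open>b\<close> are both deleted or both kept: deleting only \<open>a\<close> isolates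
  \<open>b\<close>, deleting only \<open>b\<close> isolates the first \<open>a\<close>. If both go,
  only the membership of \<open>a\<close> in \<open>\<sigma>\<close> has to be adjusted; if both
  stay, the first block just changes its length by two.\<close>

lemma no_even_deletion_step:
  assumes "a \<noteq> b" "a \<notin> set v" "b \<in> set v"
  shows "no_even_deletion (a # b # a # v) \<longleftrightarrow> no_even_deletion (b # v)"
proof
  assume w: "no_even_deletion (a # b # a # v)"
  show "no_even_deletion (b # v)"
    unfolding no_even_deletion_def
  proof (intro allI impI notI)
    fix \<sigma>
    assume s: "\<sigma> \<subset> set (b # v) \<and> \<sigma> \<noteq> {}" and e: "even_blocks \<sigma> (b # v)"
    have a: "a \<notin> \<sigma>" using s assms by auto
    show False
    proof (cases "b \<in> \<sigma>")
      case True
      have "even_blocks (insert a \<sigma>) v"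
        using e True even_blocks_cong[of v "insert a \<sigma>" \<sigma>] assms(2)
        by (auto simp: even_blocks_Cons_mem)
      then have "even_blocks (insert a \<sigma>) (a # b # a # v)"
        using True by (simp add: even_blocks_Cons_mem)
      moreover have "insert a \<sigma> \<subset> set (a # b # a # v)" using s assms a by auto
      ultimately show False using w unfolding no_even_deletion_def by blast
    next
      case False
      then have "even_blocks \<sigma> (a # b # a # v)"
        using e a by (auto simp: even_blocks_Cons_notmem)
      moreover have "\<sigma> \<subset> set (a # b # a # v)" using s by auto
      ultimately show False using w s unfolding no_even_deletion_def by blast
    qed
  qed
next
  assume w: "no_even_deletion (b # v)"
  show "no_even_deletion (a # b # a # v)"
    unfolding no_even_deletion_def
  proof (intro allI impI notI)
    fix \<sigma>
    assume s: "\<sigma> \<subset> set (a # b # a # v) \<and> \<sigma> \<noteq> {}" and e: "even_blocks \<sigma> (a # b # a # v)"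
    show False
    proof (cases "a \<in> \<sigma>")
      case True
      have b: "b \<in> \<sigma>" using e True by (auto split: if_splits)
      have "even_blocks \<sigma> v" using e True b by (simp add: even_blocks_Cons_mem)
      then have "even_blocks (\<sigma> - {a}) v"
        using even_blocks_cong[of v "\<sigma> - {a}" \<sigma>] assms(2) by auto
      then have "even_blocks (\<sigma> - {a}) (b # v)"
        using b assms(1) by (simp add: even_blocks_Cons_mem)
      moreover have "\<sigma> - {a} \<subset> set (b # v)" "\<sigma> - {a} \<noteq> {}" using s True b assms by auto
      ultimately show False using w unfolding no_even_deletion_def by blast
    next
      case False
      have b: "b \<notin> \<sigma>" using e False by auto
      then have "even_blocks \<sigma> (b # v)"
        using e False by (auto simp: even_blocks_Cons_notmem)
      moreover have "\<sigma> \<subset> set (b # v)" using s False b by auto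
      ultimately show False using w s unfolding no_even_deletion_def by blast
    qed
  qed
qed

section \<open>Alternating walks of two involutions\<close>

definition fpf_involution_on :: "'a set \<Rightarrow> ('a \<Rightarrow> 'a) \<Rightarrow> bool" where
  "fpf_involution_on X f \<longleftrightarrow> (\<forall>x \<in> X. f x \<in> X \<and> f (f x) = x \<and> f x \<noteq> x)"

text \<open>Records every second vertex of the path alternating between \<open>t\<close> and
  \<open>f\<close>; the skipped vertices are the points \<open>t (walk f t x k)\<close>.\<close>

definition walk :: "('a \<Rightarrow> 'a) \<Rightarrow> ('a \<Rightarrow> 'a) \<Rightarrow> 'a \<Rightarrow> nat \<Rightarrow> 'a" where
  "walk f t x k = ((f \<circ> t) ^^ k) x"

lemma walk_0 [simp]: "walk f t x 0 = x"
  and walk_Suc: "walk f t x (Suc k) = f (t (walk f t x k))"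
  by (simp_all add: walk_def)

lemma walk_shift: "walk f t x i = walk f t x j \<Longrightarrow> walk f t x (i + d) = walk f t x (j + d)"
  by (induction d) (simp_all add: walk_Suc)

text \<open>Instantiated twice below: with \<open>\<beta>\<close> from \<open>s\<close> and with
  \<open>\<alpha>\<close> from \<open>\<alpha> s\<close>, where \<open>t\<close> is the partner map
  \<open>\<tau>\<close> both times.\<close>

locale involution_pair =
  fixes X :: "'a set" and f t :: "'a \<Rightarrow> 'a" and x :: 'a
  assumes finite_X: "finite X"
    and f: "fpf_involution_on X f"
    and t: "fpf_involution_on X t"
    and x: "x \<in> X"
begin

abbreviation y :: "nat \<Rightarrow> 'a" where "y \<equiv> walk f t x"

lemma f_simps: "p \<in> X \<Longrightarrow> f p \<in> X" "p \<in> X \<Longrightarrow> f (f p) = p" "p \<in> X \<Longrightarrow> f p \<noteq> p"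
  using f by (auto simp: fpf_involution_on_def)

lemma t_simps: "p \<in> X \<Longrightarrow> t p \<in> X" "p \<in> X \<Longrightarrow> t (t p) = p" "p \<in> X \<Longrightarrow> t p \<noteq> p"
  using t by (auto simp: fpf_involution_on_def)

lemma walk_in: "y k \<in> X"
  by (induction k) (simp_all add: x walk_Suc f_simps t_simps)

lemma f_walk_Suc: "f (y (Suc k)) = t (y k)"
  by (simp add: walk_Suc f_simps t_simps walk_in)

lemma walk_Suc_inject: "y (Suc i) = y (Suc j) \<Longrightarrow> y i = y j"
  by (metis f_walk_Suc t_simps(2) walk_in)

text \<open>Finiteness forces a repetition, and since each step is injective the repetition can be
  pulled back to the start.\<close>

lemma walk_periodic: obtains d where "y (Suc d) = x"
proof -
  have "\<not> inj y"
    using finite_X walk_in finite_subset[of "range y" X] finite_imageD[of y UNIV] by auto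
  then obtain i j where "i < j" "y i = y j"
    unfolding inj_def by (metis linorder_neqE_nat)
  then obtain d where "y i = y (i + Suc d)"
    by (metis add_Suc_right less_imp_Suc_add)
  then have "y 0 = y (0 + Suc d)"
    by (induction i) (auto dest: walk_Suc_inject)
  then show thesis using that[of d] by simp
qed

text \<open>Such an equation folds the path onto itself: applying the involutions gives the same
  equation with the gap \<open>d\<close> reduced by two, down to a fixed point of \<open>t\<close>
  (gap 0) or of \<open>f\<close> (gap 1).\<close>

lemma walk_neq_aux: "y i \<noteq> t (y (i + d))"
proof (induction d arbitrary: i rule: less_induct)
  case (less d)
  show ?case
  proof
    assume eq: "y i = t (y (i + d))"
    then have eq': "y (Suc i) = f (y (i + d))"
      by (simp add: walk_Suc t_simps walk_in)
    consider "d = 0" | "d = 1" | e where "d = Suc (Suc e)"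
      by (metis One_nat_def not0_implies_Suc)
    then show False
    proof cases
      case 1
      then show False using eq t_simps(3)[OF walk_in[of i]] by simp
    next
      case 2
      then show False using eq' f_simps(3)[OF walk_in[of "Suc i"]] by simp
    next
      case (3 e)
      then have "y (Suc i) = t (y (Suc i + e))"
        using eq' f_walk_Suc[of "Suc i + e"] by simp
      then show False using less.IH[of e "Suc i"] 3 by simp
    qed
  qed
qed

lemma walk_neq: "y i \<noteq> t (y j)"
proof (cases "i \<le> j")
  case True
  then show ?thesis using walk_neq_aux[of i "j - i"] by simp
next
  case False
  then show ?thesis using walk_neq_aux[of j "i - j"] t_simps(2)[OF walk_in[of j]]
    by auto
qed

text \<open>The vertex set of the alternating cycle through \<open>x\<close>.\<close>

definition orbit :: "'a set" where "orbit = range y \<union> t ` range y"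

lemma orbit_subset: "orbit \<subseteq> X"
  unfolding orbit_def by (auto simp: walk_in t_simps)

lemma start_in_orbit: "x \<in> orbit"
  unfolding orbit_def using walk_0 by (metis UnI1 rangeI)

lemma t_orbit: "p \<in> orbit \<Longrightarrow> t p \<in> orbit"
  unfolding orbit_def by (auto simp: walk_in t_simps)

lemma f_orbit:
  assumes "p \<in> orbit"
  shows "f p \<in> orbit"
proof -
  from assms consider k where "p = y k" | k where "p = t (y k)"
    unfolding orbit_def by auto
  then show ?thesis
  proof cases
    case (1 k)
    \<comment> \<open>Periodicity provides a predecessor on the walk even when
      \<open>k = 0\<close>.\<close>
    obtain d where "y (Suc d) = y 0" using walk_periodic by auto
    then have "p = y (Suc (d + k))" using 1 walk_shift[of f t x "Suc d" 0 k] by simp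
    then show ?thesis unfolding orbit_def by (auto simp: f_walk_Suc)
  next
    case (2 k)
    then have "f p = y (Suc k)" by (simp add: walk_Suc)
    then show ?thesis unfolding orbit_def by auto
  qed
qed

text \<open>The index ranges are offset by one because \<open>f\<close> matches
  \<open>t (y k)\<close> with \<open>y (Suc k)\<close>. These segments are the pieces from which the
  tilings below are assembled.\<close>

lemma f_walk_segment:
  assumes "p \<in> (\<lambda>i. t (y i)) ` {i..<j} \<union> y ` {i<..j}"
  shows "f p \<in> (\<lambda>i. t (y i)) ` {i..<j} \<union> y ` {i<..j}"
proof -
  from assms consider k where "p = t (y k)" "i \<le> k" "k < j" | k where "p = y k" "i < k" "k \<le> j"
    by auto
  then show ?thesis
  proof cases
    case (1 k)
    then have "f p = y (Suc k)" "Suc k \<in> {i<..j}" by (auto simp: walk_Suc)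
    then show ?thesis by blast
  next
    case (2 k)
    then have "f p = t (y (k - 1))" "k - 1 \<in> {i..<j}" using f_walk_Suc[of "k - 1"] by auto
    then show ?thesis by blast
  qed
qed

end


text \<open>Here \<open>s\<close> stands for position 0, \<open>full\<close> is condition (1)
  phrased for tilings, and \<open>connected\<close> says that the \<open>\<alpha>\<close>- and
  \<open>\<beta>\<close>-edges together form a connected graph.\<close>

lemma partner_of_start:
  fixes X :: "'a set" and \<alpha> \<beta> \<tau> :: "'a \<Rightarrow> 'a" and s :: 'a
  assumes fin: "finite X" and s: "s \<in> X"
    and \<alpha>: "fpf_involution_on X \<alpha>" and \<beta>: "fpf_involution_on X \<beta>" and \<tau>: "fpf_involution_on X \<tau>"
    and full: "\<And>A B. \<lbrakk>A \<subseteq> X; B \<subseteq> X; A \<inter> B = {}; s \<notin> B; A \<union> B \<noteq> {};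
        \<And>p. p \<in> A \<Longrightarrow> \<alpha> p \<in> A; \<And>p. p \<in> B \<Longrightarrow> \<beta> p \<in> B;
        \<And>p. p \<in> A \<union> B \<Longrightarrow> \<tau> p \<in> A \<union> B\<rbrakk> \<Longrightarrow> A \<union> B = X"
    and connected: "\<And>Q. \<lbrakk>Q \<subseteq> X; Q \<noteq> {}; \<And>p. p \<in> Q \<Longrightarrow> \<alpha> p \<in> Q; \<And>p. p \<in> Q \<Longrightarrow> \<beta> p \<in> Q\<rbrakk>
        \<Longrightarrow> s \<in> Q"
    and neq: "\<alpha> s \<noteq> \<beta> s"
  shows "\<tau> s = \<beta> (\<alpha> s)"
proof -
  define b where "b = \<alpha> s"
  have b: "b \<in> X" "\<alpha> b = s" "b \<noteq> s" using \<alpha> s by (auto simp: b_def fpf_involution_on_def)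
  interpret P: involution_pair X \<beta> \<tau> s
    by unfold_locales (use fin s \<beta> \<tau> in auto)
  interpret C: involution_pair X \<alpha> \<tau> b
    by unfold_locales (use fin b \<alpha> \<tau> in auto)
  let ?y = "P.y" and ?z = "C.y"
  \<comment> \<open>The complement of the orbit would be a \<open>\<beta>\<close>-part avoiding
    \<open>s\<close>, hence a tiling by itself.\<close>
  have P_all: "P.orbit = X"
  proof (rule ccontr)
    assume "P.orbit \<noteq> X"
    then have ne: "X - P.orbit \<noteq> {}" using P.orbit_subset by auto
    have "{} \<union> (X - P.orbit) = X"
    proof (rule full)
      fix p assume p: "p \<in> X - P.orbit"
      then show "\<beta> p \<in> X - P.orbit"
        using P.f_orbit[of "\<beta> p"] P.f_simps[of p] by auto
    next
      fix p assume p: "p \<in> {} \<union> (X - P.orbit)"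
      then show "\<tau> p \<in> {} \<union> (X - P.orbit)"
        using P.t_orbit[of "\<tau> p"] P.t_simps[of p] by auto
    qed (use ne P.start_in_orbit in auto)
    then show False using P.start_in_orbit s by blast
  qed
  have C_all: "C.orbit = X"
  proof -
    have "C.orbit \<union> {} = X"
      by (rule full) (use C.orbit_subset C.start_in_orbit C.f_orbit C.t_orbit in auto)
    then show ?thesis by simp
  qed
  \<comment> \<open>The minimal \<open>k\<close> is the first time at which the walk from
    \<open>s\<close> meets the letter at \<open>b\<close>, at either occurrence.\<close>
  have "\<exists>k. b \<in> {?y k, \<tau> (?y k)}"
    using b(1) unfolding P_all[symmetric] P.orbit_def by auto
  then obtain k where k: "b \<in> {?y k, \<tau> (?y k)}"
    and k_min: "\<And>j. j < k \<Longrightarrow> b \<notin> {?y j, \<tau> (?y j)}"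
    using exists_least_iff[of "\<lambda>k. b \<in> {?y k, \<tau> (?y k)}"] by blast
  \<comment> \<open>A repetition up to time \<open>k\<close> would shift the visit at time
    \<open>k\<close> to an earlier one.\<close>
  have y_inj: "?y i \<noteq> ?y j" if "i < j" "j \<le> k" for i j
  proof
    assume "?y i = ?y j"
    then have "?y (i + (k - j)) = ?y k"
      using walk_shift[of \<beta> \<tau> s i j "k - j"] that by simp
    moreover have "i + (k - j) < k" using that by simp
    ultimately show False using k k_min[of "i + (k - j)"] by simp
  qed
  \<comment> \<open>Otherwise the walk arrives at \<open>\<tau> b\<close>, and the single domino
    \<open>{s, b}\<close> closes it up to a tiling. This covers \<open>X\<close>, so
    \<open>\<beta> b\<close> lies in the \<open>\<beta>\<close>-part, which would then contain
    \<open>b\<close>.\<close>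
  have b_y: "b = ?y k"
  proof (rule ccontr)
    assume "b \<noteq> ?y k"
    then have bk: "b = \<tau> (?y k)" using k by simp
    let ?A = "{s, b}" and ?B = "(\<lambda>i. \<tau> (?y i)) ` {0..<k} \<union> ?y ` {0<..k}"
    have bB: "b \<notin> ?B"
    proof
      assume "b \<in> ?B"
      then consider i where "b = \<tau> (?y i)" "i < k" | i where "b = ?y i" "i \<le> k" by auto
      then show False
        using k_min \<open>b \<noteq> ?y k\<close> by (metis insertCI order_le_less)
    qed
    have sB: "s \<notin> ?B" using P.walk_neq[of 0] y_inj[of 0] by auto
    have all: "?A \<union> ?B = X"
    proof (rule full)
      show "?A \<subseteq> X" "?B \<subseteq> X" using s b P.walk_in P.t_simps by auto
      show "?A \<inter> ?B = {}" "s \<notin> ?B" using sB bB by auto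
      fix p
      show "p \<in> ?A \<Longrightarrow> \<alpha> p \<in> ?A" using b b_def by auto
      show "p \<in> ?B \<Longrightarrow> \<beta> p \<in> ?B" by (rule P.f_walk_segment)
      show "\<tau> p \<in> ?A \<union> ?B" if "p \<in> ?A \<union> ?B"
      proof -
        have tb: "\<tau> b = ?y k" using bk P.t_simps(2)[OF P.walk_in] by simp
        from that consider "p = b" | i where "p = \<tau> (?y i)" "i < k" | i where "p = ?y i" "i \<le> k"
          by (metis (no_types, lifting) Un_iff atLeastLessThan_iff bk empty_iff greaterThanAtMost_iff imageE insert_iff le0 walk_0)
        then show ?thesis
        proof cases
          case 1
          then show ?thesis using tb by (cases k) auto
        next
          case (2 i)
          then have "\<tau> p = ?y i" by (simp add: P.t_simps P.walk_in)
          then show ?thesis using 2 by (cases i) auto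
        next
          case (3 i)
          then show ?thesis using bk by (cases "i = k") auto
        qed
      qed
    qed auto
    have "\<beta> b \<in> X" "\<beta> b \<noteq> b" "\<beta> b \<noteq> s" using P.f_simps[OF b(1)] neq by (auto simp: b_def)
    then have "\<beta> b \<in> ?B" using all by blast
    then have "\<beta> (\<beta> b) \<in> ?B" by (rule P.f_walk_segment)
    then show False using bB b P.f_simps(2) by simp
  qed
  have k0: "k \<noteq> 0" using b_y b(3) by (cases k) auto
  have \<beta>b: "\<beta> b = \<tau> (?y (k - 1))" using P.f_walk_Suc[of "k - 1"] k0 b_y by simp
  show ?thesis
  proof (cases "k = 1")
    case True
    then show ?thesis using \<beta>b by (simp add: b_def)
  next
    case False
    then have k2: "k \<ge> 2" using k0 by simp
    \<comment> \<open>All occurrences of the letters visited by \<open>y\<close> before time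
      \<open>k\<close>; this set is closed under \<open>\<tau>\<close>.\<close>
    define L where "L = ?y ` {..<k} \<union> (\<lambda>i. \<tau> (?y i)) ` {..<k}"
    have tL: "\<tau> p \<in> L \<longleftrightarrow> p \<in> L" if "p \<in> X" for p
    proof -
      have *: "\<tau> q \<in> L" if "q \<in> L" for q
        using that unfolding L_def by (auto simp: P.t_simps P.walk_in)
      show ?thesis using *[of p] *[of "\<tau> p"] that P.t_simps(2) by auto
    qed
    have bL: "b \<notin> L" using k_min unfolding L_def by blast
    have yL: "?y i \<in> L" if "i < k" for i using that unfolding L_def by blast
    have y1: "?y 1 \<in> L" "s \<in> L" using yL[of 1] yL[of 0] k2 by auto
    have "\<exists>r. ?z r \<in> L"
    proof -
      have "?y 1 \<in> C.orbit" using C_all P.walk_in by auto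
      then obtain r where "?y 1 = ?z r \<or> ?y 1 = \<tau> (?z r)" unfolding C.orbit_def by auto
      then show ?thesis using y1 tL[OF C.walk_in] by metis
    qed
    then obtain r where r: "?z r \<in> L" and r_min: "\<And>i. i < r \<Longrightarrow> ?z i \<notin> L"
      using exists_least_iff[of "\<lambda>r. ?z r \<in> L"] by blast
    have r0: "r > 0" using r bL by (cases r) auto
    have tz: "\<tau> (?z i) \<notin> L" if "i < r" for i using tL[OF C.walk_in] r_min that by auto
    \<comment> \<open>A return to \<open>b\<close> would shift the hit of \<open>L\<close> at time
      \<open>r\<close> to an earlier time.\<close>
    have z_b: "?z i \<noteq> b" if "0 < i" "i \<le> r" for i
    proof
      assume "?z i = b"
      then have "?z (r - i) = ?z r" using walk_shift[of \<alpha> \<tau> b i 0 "r - i"] that by simp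
      then show False using r_min[of "r - i"] r that by auto
    qed
    have tz_b: "\<tau> (?z i) \<noteq> b" for i using C.walk_neq[of 0 i] by auto
    from r consider j where "?z r = ?y j" "j < k" | j where "?z r = \<tau> (?y j)" "j < k"
      unfolding L_def by auto
    then show ?thesis
    proof cases
      case (1 j)
      \<comment> \<open>Arriving at \<open>s\<close> by an \<open>\<alpha>\<close>-step means coming
        from \<open>b\<close>, but \<open>b\<close> is never of the form
        \<open>\<tau> (?z i)\<close>.\<close>
      have j0: "j \<noteq> 0"
      proof
        assume "j = 0"
        then have "?z r = s" using 1 by simp
        then have "\<tau> (?z (r - 1)) = \<alpha> s" using C.f_walk_Suc[of "r - 1"] r0 by simp
        then show False using tz_b b_def by simp
      qed
      \<comment> \<open>The cycle runs from \<open>b\<close> along \<open>z\<close> to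
        \<open>?z r = ?y j\<close> and then along \<open>y\<close> back to \<open>?y k = b\<close>.
        Disjointness holds because the first part meets \<open>L\<close> at most in
        \<open>?y j\<close>, which the second part omits.\<close>
      let ?A = "(\<lambda>i. \<tau> (?z i)) ` {0..<r} \<union> ?z ` {0<..r}"
      let ?B = "(\<lambda>i. \<tau> (?y i)) ` {j..<k} \<union> ?y ` {j<..k}"
      have BL: "p \<in> L \<or> p = b" if "p \<in> ?B" for p
        using that b_y unfolding L_def by (auto simp: order_le_less)
      have AL: "p \<noteq> b \<and> (p \<in> L \<longrightarrow> p = ?y j)" if "p \<in> ?A" for p
        using that r_min tz z_b tz_b 1(1) by (auto simp: order_le_less)
      have yB: "?y i \<notin> ?B" if "i \<le> j" for i
        using y_inj[of i] P.walk_neq[of i] order_le_less_trans[OF that] by fastforce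
      have sB: "s \<notin> ?B" using yB[of 0] by simp
      have sA: "s \<notin> ?A" using AL[of s] y1(2) y_inj[of 0 j] j0 1(2) by auto
      have "?A \<union> ?B = X"
      proof (rule full)
        show "?A \<subseteq> X" "?B \<subseteq> X"
          by (auto simp: P.walk_in P.t_simps C.walk_in)
        show "?A \<inter> ?B = {}"
        proof (rule equals0I, elim IntE)
          fix p assume "p \<in> ?A" "p \<in> ?B"
          from AL[OF this(1)] BL[OF this(2)] have "p = ?y j" by metis
          then show False using \<open>p \<in> ?B\<close> yB[of j] by simp
        qed
        show "s \<notin> ?B" by (rule sB)
        show "?A \<union> ?B \<noteq> {}" using r0 by auto
        fix p
        show "p \<in> ?A \<Longrightarrow> \<alpha> p \<in> ?A" by (rule C.f_walk_segment)
        show "p \<in> ?B \<Longrightarrow> \<beta> p \<in> ?B" by (rule P.f_walk_segment)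
        show "\<tau> p \<in> ?A \<union> ?B" if "p \<in> ?A \<union> ?B"
        proof -
          from that consider i where "p = \<tau> (?z i)" "i < r" | i where "p = ?z i" "0 < i" "i \<le> r"
            | i where "p = \<tau> (?y i)" "j \<le> i" "i < k" | i where "p = ?y i" "j < i" "i \<le> k"
            by auto
          then show ?thesis
          proof cases
            case (1 i)
            then have "\<tau> p = ?z i" by (simp add: P.t_simps C.walk_in)
            moreover have "b \<in> ?B" using b_y \<open>j < k\<close> by auto
            ultimately show ?thesis using 1 by (cases i) auto
          next
            case (2 i)
            then show ?thesis using \<open>?z r = ?y j\<close> \<open>j < k\<close> by (cases "i = r") auto
          next
            case (3 i)
            then have "\<tau> p = ?y i" by (simp add: P.t_simps P.walk_in)
            moreover have "?y j \<in> ?A" using \<open>?z r = ?y j\<close> r0 by (metis UnI2 greaterThanAtMost_iff imageI order_refl)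
            ultimately show ?thesis using 3 by (cases "i = j") auto
          next
            case (4 i)
            moreover have "\<tau> b \<in> ?A" using r0 by force
            ultimately show ?thesis using b_y by (cases "i = k") auto
          qed
        qed
      qed
      then show ?thesis using s sA sB by (metis UnE)
    next
      case (2 j)
      \<comment> \<open>The orientation is now opposite: the cycle runs from \<open>s\<close> along
        \<open>y\<close> to \<open>?y j\<close>, by \<open>\<tau>\<close> to \<open>?z r\<close>,
        backwards along \<open>z\<close> to \<open>b\<close>, and by \<open>\<alpha>\<close> to
        \<open>s\<close>.\<close>
      let ?A = "insert s (insert b ((\<lambda>i. \<tau> (?z i)) ` {0..<r} \<union> ?z ` {0<..r}))"
      let ?B = "(\<lambda>i. \<tau> (?y i)) ` {0..<j} \<union> ?y ` {0<..j}"
      have BL: "p \<in> L" if "p \<in> ?B" for p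
        using that 2(2) unfolding L_def by auto
      have AL: "p \<in> L \<longrightarrow> p = s \<or> p = \<tau> (?y j)" if "p \<in> ?A" for p
        using that r_min tz bL 2(1) by (auto simp: order_le_less)
      have sB: "s \<notin> ?B" using P.walk_neq[of 0] y_inj[of 0] 2(2) by auto
      have tB: "\<tau> (?y j) \<notin> ?B"
      proof
        assume "\<tau> (?y j) \<in> ?B"
        then consider i where "\<tau> (?y j) = \<tau> (?y i)" "i < j" | i where "\<tau> (?y j) = ?y i"
          by auto
        then show False
        proof cases
          case (1 i)
          then have "?y j = ?y i" by (metis P.t_simps(2) P.walk_in)
          then show False using y_inj[of i j] 1(2) 2(2) by auto
        next
          case (2 i)
          then show False using P.walk_neq[of i j] by simp
        qed
      qed
      have disj: "?A \<inter> ?B = {}"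
      proof (rule equals0I, elim IntE)
        fix p assume "p \<in> ?A" "p \<in> ?B"
        from AL[OF this(1)] BL[OF this(2)] have "p = s \<or> p = \<tau> (?y j)" by metis
        then show False using \<open>p \<in> ?B\<close> sB tB by metis
      qed
      have A_closed: "\<alpha> p \<in> ?A" if "p \<in> ?A" for p
        using that b b_def C.f_walk_segment[of p 0 r] by auto
      have B_closed: "\<beta> p \<in> ?B" if "p \<in> ?B" for p
        using that by (rule P.f_walk_segment)
      have B_sub: "?B \<subseteq> X" by (auto simp: P.walk_in P.t_simps)
      have all: "?A \<union> ?B = X"
      proof (rule full)
        show "?A \<subseteq> X" using s b by (auto simp: P.t_simps C.walk_in)
        fix p
        show "\<tau> p \<in> ?A \<union> ?B" if "p \<in> ?A \<union> ?B"
        proof -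
          from that consider "p = ?y 0" | "p = ?z 0"
            | i where "p = \<tau> (?z i)" "i < r" | i where "p = ?z i" "i \<le> r"
            | i where "p = \<tau> (?y i)" "i < j" | i where "p = ?y i" "i \<le> j"
            by auto
          then consider i where "p = \<tau> (?z i)" "i < r" | i where "p = ?z i" "i \<le> r"
            | i where "p = \<tau> (?y i)" "i < j" | i where "p = ?y i" "i \<le> j"
            by cases (use zero_le in metis)+
          then show ?thesis
          proof cases
            case (1 i)
            then have "\<tau> p = ?z i" by (simp add: P.t_simps C.walk_in)
            then show ?thesis using 1 by (cases i) auto
          next
            case (2 i)
            have "\<tau> (?z r) = ?y j" using \<open>?z r = \<tau> (?y j)\<close> by (simp add: P.t_simps P.walk_in)
            then show ?thesis using 2 by (cases "i = r"; cases j) auto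
          next
            case (3 i)
            then have "\<tau> p = ?y i" by (simp add: P.t_simps P.walk_in)
            then show ?thesis using 3 by (cases i) auto
          next
            case (4 i)
            moreover have "\<tau> (?y j) \<in> ?A" using \<open>?z r = \<tau> (?y j)\<close> r0
              by (metis UnI2 greaterThanAtMost_iff imageI insertI2 order_refl)
            ultimately show ?thesis by (cases "i = j") auto
          qed
        qed
      qed (use disj sB A_closed B_closed B_sub in auto)
      txt \<open>As \<open>A\<close> is the complement of \<open>B\<close>, the set \<open>B\<close> is closed under both \<open>\<alpha>\<close> and \<open>\<beta>\<close>.\<close>
      have "?B = {}"
      proof (rule ccontr)
        assume "?B \<noteq> {}"
        then have "s \<in> ?B"
        proof (rule connected[OF B_sub])
          fix p assume p: "p \<in> ?B"
          then have "\<alpha> p \<in> X" "\<alpha> (\<alpha> p) = p" using B_sub C.f_simps by blast+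
          then show "\<alpha> p \<in> ?B" using all disj p A_closed[of "\<alpha> p"] by (metis IntI Un_iff empty_iff)
        qed (rule B_closed)
        then show False using sB by contradiction
      qed
      \<comment> \<open>With \<open>j = 0\<close> the set \<open>?A\<close> meets \<open>L\<close>
        at most in \<open>s\<close> and \<open>\<tau> s\<close>, yet it now contains
        \<open>?y 1\<close>, which is neither.\<close>
      then have "j = 0" by (cases j) auto
      moreover have "?y 1 \<in> ?A" using all P.walk_in[of 1] \<open>?B = {}\<close> by (metis Un_empty_right)
      ultimately show ?thesis using AL[of "?y 1"] y1 y_inj[of 0 1] k2 P.walk_neq[of 1 0] by auto
    qed
  qed
qed

section \<open>Positions in a double occurrence word\<close>

text \<open>The conditions on \<open>p\<close> say that the cut before \<open>p\<close> splits no
  domino: dominoes of \<open>A\<close> start at even positions, those of \<open>B\<close> at odd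
  ones.\<close>

lemma even_blocks_drop_of_dominoes:
  fixes A B :: "nat set"
  assumes A: "\<And>p. even p \<Longrightarrow> p \<in> A \<longleftrightarrow> Suc p \<in> A"
    and B: "\<And>p. odd p \<Longrightarrow> p \<in> B \<longleftrightarrow> Suc p \<in> B"
    and disj: "A \<inter> B = {}" and bound: "A \<union> B \<subseteq> {..<length w}"
    and \<sigma>: "\<And>p. p < length w \<Longrightarrow> w ! p \<in> \<sigma> \<longleftrightarrow> p \<notin> A \<union> B"
  shows "\<lbrakk>odd p \<Longrightarrow> p \<notin> A; even p \<Longrightarrow> p \<notin> B\<rbrakk> \<Longrightarrow> even_blocks \<sigma> (drop p w)"
proof (induction "length w - p" arbitrary: p rule: less_induct)
  case less
  show ?case
  proof (cases "p < length w")
    case False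
    then show ?thesis by simp
  next
    case True
    then have drop: "drop p w = w ! p # drop (Suc p) w" by (simp add: Cons_nth_drop_Suc)
    show ?thesis
    proof (cases "p \<in> A \<union> B")
      case False
      have "even_blocks \<sigma> (drop (Suc p) w)"
        by (rule less.hyps) (use True False A[of p] B[of p] in auto)
      then show ?thesis using drop \<sigma>[OF True] False by (simp add: even_blocks_Cons_mem)
    next
      case p: True
      then have Suc_p: "Suc p \<in> A \<union> B" and SS: "odd p \<Longrightarrow> Suc (Suc p) \<notin> A" "even p \<Longrightarrow> Suc (Suc p) \<notin> B"
        using less.prems A[of p] B[of p] A[of "Suc p"] B[of "Suc p"] disj by auto
      then have len: "Suc p < length w" using bound by auto
      have "even_blocks \<sigma> (drop (Suc (Suc p)) w)"
        by (rule less.hyps) (use True SS in auto)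
      moreover have "drop (Suc p) w = w ! Suc p # drop (Suc (Suc p)) w"
        using len by (simp add: Cons_nth_drop_Suc)
      ultimately show ?thesis using drop \<sigma>[OF True] \<sigma>[OF len] p Suc_p by auto
    qed
  qed
qed

lemma double_occurrence_partner:
  assumes "double_occurrence_word w"
  obtains \<tau> where "fpf_involution_on {..<length w} \<tau>"
    and "\<And>p q. \<lbrakk>p < length w; q < length w\<rbrakk> \<Longrightarrow> w ! p = w ! q \<longleftrightarrow> q = p \<or> q = \<tau> p"
proof -
  have "\<exists>q. q < length w \<and> q \<noteq> p \<and> (\<forall>r < length w. w ! p = w ! r \<longleftrightarrow> r = p \<or> r = q)"
    if p: "p < length w" for p
  proof -
    have "count_list w (w ! p) = 2"
      using assms p unfolding double_occurrence_word_def by (metis count_list_0_iff nth_mem)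
    then have "card {i. i < length w \<and> w ! p = w ! i} = 2"
      by (simp add: count_list_eq_length_filter length_filter_conv_card)
    then obtain i j where ij: "{i. i < length w \<and> w ! p = w ! i} = {i, j}" "i \<noteq> j"
      by (auto simp: card_2_iff)
    have "p \<in> {i. i < length w \<and> w ! p = w ! i}" using p by simp
    then have "p = i \<or> p = j" using ij by simp
    then obtain q where "{i. i < length w \<and> w ! p = w ! i} = {p, q}" "q \<noteq> p"
      using ij by (metis insert_commute)
    then have "q < length w \<and> q \<noteq> p \<and> (\<forall>r < length w. w ! p = w ! r \<longleftrightarrow> r = p \<or> r = q)"
      by auto
    then show ?thesis by blast
  qed
  then obtain \<tau> where \<tau>: "\<And>p. p < length w \<Longrightarrow> \<tau> p < length w \<and> \<tau> p \<noteq> p \<and>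
      (\<forall>r < length w. w ! p = w ! r \<longleftrightarrow> r = p \<or> r = \<tau> p)"
    by metis
  have "\<tau> (\<tau> p) = p" if "p < length w" for p
    using \<tau>[OF that] \<tau>[of "\<tau> p"] that by metis
  then have "fpf_involution_on {..<length w} \<tau>"
    using \<tau> unfolding fpf_involution_on_def by auto
  then show thesis using that[of \<tau>] \<tau> by blast
qed

lemma no_even_deletion_nth_2:
  assumes dow: "double_occurrence_word w" and len: "length w = 2 * n" and n: "n \<ge> 2"
    and w: "no_even_deletion w"
  shows "w ! 2 = w ! 0"
proof -
  obtain \<tau> where \<tau>: "fpf_involution_on {..<2 * n} \<tau>"
    and same: "\<And>p q. \<lbrakk>p < 2 * n; q < 2 * n\<rbrakk> \<Longrightarrow> w ! p = w ! q \<longleftrightarrow> q = p \<or> q = \<tau> p"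
    using double_occurrence_partner[OF dow] len by auto
  define \<alpha> :: "nat \<Rightarrow> nat" where "\<alpha> p = (if even p then Suc p else p - 1)" for p
  define \<beta> :: "nat \<Rightarrow> nat" where "\<beta> p = (if p = 0 then 2 * n - 1 else if p = 2 * n - 1 then 0
    else if odd p then Suc p else p - 1)" for p
  have "\<tau> 0 = \<beta> (\<alpha> 0)"
  proof (rule partner_of_start[of "{..<2 * n}" 0 \<alpha> \<beta> \<tau>])
    show "fpf_involution_on {..<2 * n} \<alpha>"
      unfolding fpf_involution_on_def \<alpha>_def by (auto elim!: evenE oddE)
    show "fpf_involution_on {..<2 * n} \<beta>"
      unfolding fpf_involution_on_def \<beta>_def using n by (auto elim!: evenE oddE) presburger
    show "\<alpha> 0 \<noteq> \<beta> 0" using n by (simp add: \<alpha>_def \<beta>_def)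
  next
    fix A B :: "nat set"
    assume AB: "A \<subseteq> {..<2 * n}" "B \<subseteq> {..<2 * n}" "A \<inter> B = {}" "0 \<notin> B" "A \<union> B \<noteq> {}"
      and A: "\<And>p. p \<in> A \<Longrightarrow> \<alpha> p \<in> A" and B: "\<And>p. p \<in> B \<Longrightarrow> \<beta> p \<in> B"
      and T: "\<And>p. p \<in> A \<union> B \<Longrightarrow> \<tau> p \<in> A \<union> B"
    have inT: "p \<in> A \<union> B \<longleftrightarrow> q \<in> A \<union> B" if "p < 2 * n" "q < 2 * n" "w ! p = w ! q" for p q
      using that same[of p q] same[of q p] T[of p] T[of q] by metis
    \<comment> \<open>By \<open>inT\<close> each letter lies entirely inside or entirely outside the
      tiling; the letters outside are deleted.\<close>
    define \<sigma> where "\<sigma> = set w - (!) w ` (A \<union> B)"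
    have \<sigma>: "w ! p \<in> \<sigma> \<longleftrightarrow> p \<notin> A \<union> B" if "p < 2 * n" for p
    proof -
      have "w ! p \<in> (!) w ` (A \<union> B) \<longleftrightarrow> p \<in> A \<union> B"
        using inT[OF that] AB(1,2) by (auto simp: subset_iff image_iff)
      then show ?thesis using that len unfolding \<sigma>_def by simp
    qed
    \<comment> \<open>This rules out the one cyclic pair of \<open>\<beta>\<close>, which is not a
      pair of neighbours in the word.\<close>
    have last: "2 * n - 1 \<notin> B" using B[of "2 * n - 1"] AB(4) n by (auto simp: \<beta>_def)
    have "even_blocks \<sigma> (drop 0 w)"
    proof (rule even_blocks_drop_of_dominoes[of A B])
      fix p :: nat
      show "p \<in> A \<longleftrightarrow> Suc p \<in> A" if "even p"
        using A[of p] A[of "Suc p"] that by (auto simp: \<alpha>_def)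
      show "p \<in> B \<longleftrightarrow> Suc p \<in> B" if "odd p"
      proof (cases "p = 2 * n - 1")
        case True
        then show ?thesis using last AB(2) n by auto
      next
        case False
        moreover have "Suc p \<noteq> 2 * n - 1" using that n by (auto elim!: oddE) presburger
        ultimately show ?thesis using B[of p] B[of "Suc p"] that by (auto simp: \<beta>_def split: if_splits)
      qed
    qed (use AB len \<sigma> in auto)
    moreover have "\<sigma> \<subset> set w"
    proof -
      obtain p where p: "p \<in> A \<union> B" using AB(5) by blast
      then have "p < 2 * n" using AB by auto
      then have "w ! p \<notin> \<sigma>" "w ! p \<in> set w" using \<sigma> p len by auto
      then show ?thesis unfolding \<sigma>_def by auto
    qed
    ultimately have "\<sigma> = {}" using w unfolding no_even_deletion_def by auto
    then show "A \<union> B = {..<2 * n}" using \<sigma> AB by auto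
  next
    fix Q :: "nat set"
    assume Q: "Q \<noteq> {}" "Q \<subseteq> {..<2 * n}"
      and \<alpha>Q: "\<And>p. p \<in> Q \<Longrightarrow> \<alpha> p \<in> Q" and \<beta>Q: "\<And>p. p \<in> Q \<Longrightarrow> \<beta> p \<in> Q"
    \<comment> \<open>The least element of \<open>Q\<close> must be 0, since one of
      \<open>\<alpha>\<close> and \<open>\<beta>\<close>, depending on parity, lowers any other
      position by one.\<close>
    obtain p where p: "p \<in> Q" and min: "\<And>q. q < p \<Longrightarrow> q \<notin> Q"
      using Q(1) exists_least_iff[of "\<lambda>p. p \<in> Q"] by blast
    show "0 \<in> Q"
    proof (rule ccontr)
      assume "0 \<notin> Q"
      then have p0: "p > 0" using p by (cases p) auto
      have "p - 1 \<in> Q"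
      proof (cases "even p")
        case True
        then have "p \<noteq> 2 * n - 1" using n by auto
        then show ?thesis using \<beta>Q[OF p] True p0 by (simp add: \<beta>_def)
      next
        case False
        then show ?thesis using \<alpha>Q[OF p] by (simp add: \<alpha>_def)
      qed
      then show False using min p0 by simp
    qed
  qed (use n \<tau> in auto)
  also have "\<beta> (\<alpha> 0) = 2" using n by (simp add: \<alpha>_def \<beta>_def)
  finally have "\<tau> 0 = 2" .
  then show ?thesis using same[of 0 2] n by simp
qed

section \<open>Tangled cords\<close>

lemma tangled_cord_word_1: "tangled_cord_word (Suc 0) = [1, 1]"
  by (simp add: tangled_cord_word_def)

text \<open>Gives the shape required by \<open>no_even_deletion_step\<close>: the head 2 of the
  shifted word moves between the two 1s, hence \<open>tl\<close>.\<close>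

lemma tangled_cord_word_Suc:
  assumes "n \<ge> 1"
  shows "tangled_cord_word (Suc n) = 1 # 2 # 1 # tl (map Suc (tangled_cord_word n))"
proof -
  have "[1..<Suc n] = 1 # map Suc [1..<n]"
    using assms by (simp add: upt_conv_Cons map_Suc_upt del: upt_Suc)
  then show ?thesis
    by (simp add: tangled_cord_word_def map_concat comp_def del: upt_Suc)
qed

lemma tangled_cord_word_hd_tl: "tangled_cord_word n = 1 # tl (tangled_cord_word n)"
  by (simp add: tangled_cord_word_def)

lemma set_tangled_cord_word: "n \<ge> 1 \<Longrightarrow> set (tangled_cord_word n) = {1..n}"
  by (auto simp: tangled_cord_word_def) (metis atLeastLessThan_iff order_le_less)

lemma one_in_tl_tangled_cord_word:
  assumes "n \<ge> 1"
  shows "1 \<in> set (tl (tangled_cord_word n))"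
proof (cases "n = 1")
  case False
  then have "tangled_cord_word n = 1 # 2 # 1 # tl (map Suc (tangled_cord_word (n - 1)))"
    using tangled_cord_word_Suc[of "n - 1"] assms by simp
  then show ?thesis by simp
qed (simp add: tangled_cord_word_1)

text \<open>The renaming is arbitrary so that the induction hypothesis can be applied to
  \<open>f \<circ> Suc\<close>, absorbing the shift.\<close>

lemma no_even_deletion_tangled_cord_word:
  "\<lbrakk>n \<ge> 1; inj_on f {1..n}\<rbrakk> \<Longrightarrow> no_even_deletion (map f (tangled_cord_word n))"
proof (induction n arbitrary: f rule: nat_induct_at_least)
  case base
  then show ?case by (auto simp: tangled_cord_word_1 no_even_deletion_def)
next
  case (Suc n)
  let ?v = "tl (map (f \<circ> Suc) (tangled_cord_word n))"
  have w': "map (f \<circ> Suc) (tangled_cord_word n) = f 2 # ?v"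
    by (subst (1) tangled_cord_word_hd_tl) (simp add: numeral_2_eq_2 map_tl)
  have "inj_on (f \<circ> Suc) {1..n}"
    using Suc.prems by (intro comp_inj_on) (auto intro: inj_on_subset)
  then have IH: "no_even_deletion (f 2 # ?v)" using Suc.IH[of "f \<circ> Suc"] w' by metis
  have v: "set ?v \<subseteq> (f \<circ> Suc) ` {1..n}"
    using set_tangled_cord_word[OF Suc.hyps] w' by (metis list.set_map set_subset_Cons)
  have f1: "f 1 \<notin> (f \<circ> Suc) ` {1..n}"
  proof
    assume "f 1 \<in> (f \<circ> Suc) ` {1..n}"
    then obtain i where "f 1 = f (Suc i)" "1 \<le> i" "i \<le> n" by auto
    then show False using inj_onD[OF Suc.prems, of 1 "Suc i"] by simp
  qed
  have "f 1 \<noteq> f 2" using inj_onD[OF Suc.prems, of 1 2] Suc.hyps by auto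
  moreover have "f 1 \<notin> set ?v" using v f1 by blast
  moreover have "f 2 \<in> set ?v"
    using imageI[OF one_in_tl_tangled_cord_word[OF Suc.hyps], of "f \<circ> Suc"]
    by (simp add: map_tl[symmetric] numeral_2_eq_2)
  ultimately have "no_even_deletion (f 1 # f 2 # f 1 # ?v)"
    using no_even_deletion_step IH by metis
  then show ?case
    by (simp add: tangled_cord_word_Suc[OF Suc.hyps] map_tl)
qed

text \<open>Peeling off both copies of the first letter leaves a shorter word of the same kind. Only
  injectivity of \<open>f\<close> is claimed, since the remaining letters are arbitrary.\<close>

lemma no_even_deletion_imp_tangled_cord_word:
  "\<lbrakk>n \<ge> 1; double_occurrence_word w; length w = 2 * n; no_even_deletion w\<rbrakk>
    \<Longrightarrow> \<exists>f. inj_on f {1..n} \<and> w = map f (tangled_cord_word n)"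
proof (induction n arbitrary: w rule: nat_induct_at_least)
  case base
  then obtain x y where w: "w = [x, y]" by (auto simp: numeral_2_eq_2 length_Suc_conv)
  have "count_list w x = 0 \<or> count_list w x = 2"
    using base.prems(1) by (simp add: double_occurrence_word_def)
  then have "w = map (\<lambda>_. x) (tangled_cord_word 1)"
    using w by (auto simp: tangled_cord_word_1 split: if_splits)
  then show ?case by (intro exI[of _ "\<lambda>_. x"]) auto
next
  case (Suc n)
  have counts: "count_list w c = 0 \<or> count_list w c = 2" for c
    using Suc.prems(1) by (simp add: double_occurrence_word_def)
  have nth: "w ! 2 = w ! 0"
    using no_even_deletion_nth_2[OF Suc.prems(1,2) _ Suc.prems(3)] Suc.hyps by simp
  have "length w = Suc (Suc (Suc (2 * n - 1)))" using Suc.prems(2) Suc.hyps by simp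
  then obtain a b c v where "w = a # b # c # v"
    by (auto simp: length_Suc_conv)
  then have w: "w = a # b # a # v" using nth by simp
  have av: "a \<noteq> b" "count_list v a = 0" using counts[of a] w by (auto split: if_splits)
  have bv: "count_list v b = 1" using counts[of b] w av by (auto split: if_splits)
  have "count_list (b # v) c = 0 \<or> count_list (b # v) c = 2" for c
    using counts[of c] w av by (auto split: if_splits)
  then have dow: "double_occurrence_word (b # v)"
    by (simp add: double_occurrence_word_def)
  have mem: "a \<notin> set v" "b \<in> set v" using av(2) bv by (metis count_list_0_iff zero_neq_one)+
  then have "no_even_deletion (b # v)"
    using no_even_deletion_step[OF av(1) mem] Suc.prems(3) w by simp
  then obtain f where f: "inj_on f {1..n}" "b # v = map f (tangled_cord_word n)"
    using Suc.IH[OF dow] Suc.prems(2) w by auto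
  \<comment> \<open>The renaming of \<open>b # v\<close> moved up by one, with 1 sent to the peeled
    letter; it is injective because \<open>a\<close> does not occur in \<open>b # v\<close>.\<close>
  define g where "g i = (if i = 1 then a else f (i - 1))" for i
  have b: "b = f 1" "v = tl (map f (tangled_cord_word n))"
    using f(2) by (subst (asm) tangled_cord_word_hd_tl, simp, metis list.sel(3) f(2))
  have a: "a \<notin> f ` {1..n}"
    using f(2) mem av(1) set_tangled_cord_word[OF Suc.hyps] by (metis list.set_map set_ConsD)
  have "map (g \<circ> Suc) (tangled_cord_word n) = map f (tangled_cord_word n)"
    using set_tangled_cord_word[OF Suc.hyps] by (auto simp: g_def)
  then have "v = tl (map (g \<circ> Suc) (tangled_cord_word n))" using b by metis
  moreover have "g 1 = a" "g 2 = b" using b by (simp_all add: g_def)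
  ultimately have "w = map g (tangled_cord_word (Suc n))"
    using w by (simp add: tangled_cord_word_Suc[OF Suc.hyps] map_tl)
  moreover have "inj_on g {1..Suc n}"
  proof -
    have "inj_on (g \<circ> Suc) {1..n}"
      using f(1) inj_on_cong[of "{1..n}" "g \<circ> Suc" f] by (simp add: g_def)
    then have "inj_on g (Suc ` {1..n})" by (rule inj_on_imageI)
    moreover have "g ` (Suc ` {1..n}) = f ` {1..n}"
      unfolding image_image by (rule image_cong) (auto simp: g_def)
    then have "g 1 \<notin> g ` (Suc ` {1..n})" using a by (simp add: g_def)
    moreover have "{1..Suc n} = insert 1 (Suc ` {1..n})"
      by (simp add: image_Suc_atLeastAtMost atLeastAtMost_insertL)
    ultimately show ?thesis by (simp only: inj_on_insert) blast
  qed
  ultimately show ?case by blast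
qed

theorem theorem4p7:
  fixes n :: nat and w :: "nat list"
  assumes "double_occurrence_word w"
    and "set w \<subseteq> {1..n}"
    and "length w = 2 * n"
  shows "(\<forall>\<sigma>. \<sigma> \<subset> {1..n} \<and> \<sigma> \<noteq> {} \<longrightarrow> (\<exists>u \<in> set (delete_letters w \<sigma>). odd (length u)))
    \<longleftrightarrow> equal_up_to_renaming n w (tangled_cord_word n)"
proof -
  have n: "n \<ge> 1" using assms(1,3) by (cases n) (auto simp: double_occurrence_word_def)
  \<comment> \<open>Counting positions by letters shows that all \<open>n\<close> letters occur, so
    \<open>set w\<close> is the full alphabet.\<close>
  have "2 * n = (\<Sum>a \<in> set w. count_list w a)"
    using assms(3) sum_count_set[of w "set w"] by simp
  also have "\<dots> = 2 * card (set w)"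
  proof -
    have "count_list w a = 2" if "a \<in> set w" for a
      using assms(1) that unfolding double_occurrence_word_def by (metis count_list_0_iff)
    then show ?thesis by simp
  qed
  finally have set_w: "set w = {1..n}"
    using assms(2) by (intro card_subset_eq) auto
  have "(\<forall>\<sigma>. \<sigma> \<subset> {1..n} \<and> \<sigma> \<noteq> {} \<longrightarrow> (\<exists>u \<in> set (delete_letters w \<sigma>). odd (length u)))
      \<longleftrightarrow> no_even_deletion w"
    unfolding no_even_deletion_def even_blocks_iff_delete[symmetric] set_w by blast
  also have "\<dots> \<longleftrightarrow> (\<exists>f. inj_on f {1..n} \<and> w = map f (tangled_cord_word n))"
    using no_even_deletion_imp_tangled_cord_word[OF n assms(1,3)]
      no_even_deletion_tangled_cord_word[OF n] by blast
  \<comment> \<open>The image of \<open>f\<close> is \<open>set w\<close>, which makes an injective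
    renaming a bijection of the alphabet.\<close>
  also have "\<dots> \<longleftrightarrow> equal_up_to_renaming n w (tangled_cord_word n)"
    using set_tangled_cord_word[OF n] set_w
    unfolding equal_up_to_renaming_def bij_betw_def by (metis list.set_map)
  finally show ?thesis .
qed

end
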